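(* An eulerian graph $G$ has a rooted $2$-odd decomposition if and only if $G$ is non-bipartite and has an even number of edges.
   Context: Graphs are finite and may have multiple edges and loops (a graph with a loop is non-bipartite). A graph is eulerian if it is connected and every vertex has even degree. A decomposition of a graph $G$ is a set of subgraphs whose edge sets partition $E(G)$. A $2$-odd decomposition is a decomposition $\{G_1,G_2\}$ in which each $G_i$ is an eulerian subgraph (a closed trail) with an odd number of edges; it is rooted if some vertex of $G$ lies in both $G_1$ and $G_2$. *)

theory Defs
  imports "HOL-Library.Uprod" "HOL-Library.Disjoint_Sets"
begin

text \<open>
  Finite undirected graphs with parallel edges and loops. The library has no undirected
  multigraphs, so an edge is a name of type \<open>'e\<close>, mapped by \<open>ends\<close> to the
  unordered pair of its (possibly equal) end vertices. Only the values of \<open>ends\<close> on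
  \<open>edges\<close> are meaningful.
\<close>

record ('v, 'e) mgraph =
  verts :: "'v set"
  edges :: "'e set"
  ends :: "'e \<Rightarrow> 'v uprod"

definition multigraph :: "('v, 'e) mgraph \<Rightarrow> bool" where
  "multigraph G \<longleftrightarrow> finite (verts G) \<and> finite (edges G) \<and>
     (\<forall>e\<in>edges G. set_uprod (ends G e) \<subseteq> verts G)"

text \<open>A loop at \<open>v\<close> is counted by both summands, so it contributes 2 to the degree.\<close>

definition degree :: "('v, 'e) mgraph \<Rightarrow> 'v \<Rightarrow> nat" where
  "degree G v = card {e \<in> edges G. v \<in> set_uprod (ends G e)}
     + card {e \<in> edges G. ends G e = Upair v v}"

definition adj_rel :: "('v, 'e) mgraph \<Rightarrow> ('v \<times> 'v) set" where
  "adj_rel G = {(u, v). \<exists>e\<in>edges G. ends G e = Upair u v}"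

definition connected_graph :: "('v, 'e) mgraph \<Rightarrow> bool" where
  "connected_graph G \<longleftrightarrow> verts G \<noteq> {} \<and> (\<forall>u\<in>verts G. \<forall>v\<in>verts G. (u, v) \<in> (adj_rel G)\<^sup>*)"

definition eulerian :: "('v, 'e) mgraph \<Rightarrow> bool" where
  "eulerian G \<longleftrightarrow> connected_graph G \<and> (\<forall>v\<in>verts G. even (degree G v))"

definition bipartite :: "('v, 'e) mgraph \<Rightarrow> bool" where
  "bipartite G \<longleftrightarrow> (\<exists>A B. A \<union> B = verts G \<and> A \<inter> B = {} \<and>
     (\<forall>e\<in>edges G. \<exists>a\<in>A. \<exists>b\<in>B. ends G e = Upair a b))"

definition subgraph :: "('v, 'e) mgraph \<Rightarrow> ('v, 'e) mgraph \<Rightarrow> bool" where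
  "subgraph H G \<longleftrightarrow> multigraph H \<and> verts H \<subseteq> verts G \<and> edges H \<subseteq> edges G \<and>
     (\<forall>e\<in>edges H. ends H e = ends G e)"

text \<open>
  Injectivity says that different members of \<open>D\<close> have different edge sets; without it
  the image \<open>edges ` D\<close> would identify members differing only in their vertices.
\<close>

definition decomposition :: "('v, 'e) mgraph \<Rightarrow> ('v, 'e) mgraph set \<Rightarrow> bool" where
  "decomposition G D \<longleftrightarrow> (\<forall>H\<in>D. subgraph H G) \<and> inj_on edges D \<and>
     partition_on (edges G) (edges ` D)"

definition two_odd_decomposition :: "('v, 'e) mgraph \<Rightarrow> ('v, 'e) mgraph set \<Rightarrow> bool" where
  "two_odd_decomposition G D \<longleftrightarrow> decomposition G D \<and> card D = 2 \<and>
     (\<forall>H\<in>D. eulerian H \<and> odd (card (edges H)))"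

definition rooted :: "('v, 'e) mgraph \<Rightarrow> ('v, 'e) mgraph set \<Rightarrow> bool" where
  "rooted G D \<longleftrightarrow> (\<exists>v\<in>verts G. \<forall>H\<in>D. v \<in> verts H)"

end

theory Submission
  imports Defs
begin

text \<open>
  Fix an Euler tour of \<open>G\<close>. If some vertex is visited at two positions of different
  parity, cutting the tour there yields two closed trails through that vertex, one of them odd,
  hence both odd as the number of edges is even. Otherwise the parity of the visits is a proper
  2-colouring of \<open>G\<close>. Conversely, the number of edges of a bipartite graph is the sum of
  the degrees on one side, so a bipartite graph has no odd eulerian subgraph.
\<close>

section \<open>Walks and degrees\<close>

text \<open>Only the edges are listed: each may be crossed in either direction, and the start vertex
  determines the vertices passed. A trail is a walk with a \<open>distinct\<close> list.\<close>

fun walk :: "('e \<Rightarrow> 'v uprod) \<Rightarrow> 'v \<Rightarrow> 'e list \<Rightarrow> 'v \<Rightarrow> bool" where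
  "walk f u [] v \<longleftrightarrow> u = v"
| "walk f u (e # es) v \<longleftrightarrow> (\<exists>w. f e = Upair u w \<and> walk f w es v)"

text \<open>Degree relative to an edge set, so that parities can be counted along a trail without
  building a graph on it.\<close>

definition deg :: "('e \<Rightarrow> 'v uprod) \<Rightarrow> 'e set \<Rightarrow> 'v \<Rightarrow> nat" where
  "deg f F x = card {e \<in> F. x \<in> set_uprod (f e)} + card {e \<in> F. f e = Upair x x}"

lemma degree_eq_deg: "degree G = deg (ends G) (edges G)"
  by (simp add: fun_eq_iff degree_def deg_def)

lemma in_set_uprodE:
  assumes "v \<in> set_uprod p"
  obtains w where "p = Upair v w"
  using assms by (cases p) auto

lemma walk_append: "walk f u (xs @ ys) v \<longleftrightarrow> (\<exists>w. walk f u xs w \<and> walk f w ys v)"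
  by (induction xs arbitrary: u) auto

lemma walk_end_unique: "walk f u es v \<Longrightarrow> walk f u es w \<Longrightarrow> v = w"
  by (induction es arbitrary: u) auto

text \<open>The walk enters or leaves \<open>e\<close> at \<open>x\<close>, so the cut falls before
  or after \<open>e\<close>. Closed trails are rotated at such cuts.\<close>

lemma walk_visits:
  assumes "walk f u es v" "e \<in> set es" "x \<in> set_uprod (f e)"
  obtains xs ys where "es = xs @ ys" "walk f u xs x" "walk f x ys v"
proof -
  obtain as bs where es: "es = as @ e # bs"
    using assms(2) by (metis split_list)
  then obtain a b where w: "walk f u as a" "f e = Upair a b" "walk f b bs v"
    using assms(1) by (auto simp: walk_append)
  consider "x = a" | "x = b"
    using assms(3) w(2) by auto
  then show ?thesis
  proof cases
    case 1
    then show ?thesis using that[of as "e # bs"] es w by auto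
  next
    case 2
    then show ?thesis using that[of "as @ [e]" bs] es w by (auto simp: walk_append)
  qed
qed

text \<open>The two indicators are kept separate so that a loop, with \<open>a = b\<close>, adds
  2.\<close>

lemma deg_insert:
  assumes "finite F" "e \<notin> F" "f e = Upair a b"
  shows "deg f (insert e F) x = deg f F x + of_bool (x = a) + of_bool (x = b)"
proof -
  have "{e' \<in> insert e F. P e'} = (if P e then insert e {e' \<in> F. P e'} else {e' \<in> F. P e'})" for P
    by auto
  then show ?thesis
    using assms by (auto simp: deg_def)
qed

lemma deg_Un_disjoint:
  assumes "finite F" "finite F'" "F \<inter> F' = {}"
  shows "deg f (F \<union> F') x = deg f F x + deg f F' x"
proof -
  have "card {e \<in> F \<union> F'. P e} = card {e \<in> F. P e} + card {e \<in> F'. P e}" for P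
    by (subst card_Un_disjoint[symmetric]) (use assms in \<open>auto intro: arg_cong[where f = card]\<close>)
  then show ?thesis
    by (simp add: deg_def)
qed

lemma deg_pos:
  assumes "deg f F x > 0"
  obtains e where "e \<in> F" "x \<in> set_uprod (f e)"
proof -
  have "{e \<in> F. x \<in> set_uprod (f e)} \<noteq> {} \<or> {e \<in> F. f e = Upair x x} \<noteq> {}"
    using assms unfolding deg_def by (metis add_0 card.empty less_irrefl)
  then show ?thesis
    using that by auto
qed

text \<open>The first edge flips the parity at its two ends, which moves the start from
  \<open>u\<close> to the next vertex; a loop flips nothing.\<close>

lemma even_deg_trail:
  assumes "walk f u es v" "distinct es"
  shows "even (deg f (set es) x) \<longleftrightarrow> (x = u \<longleftrightarrow> x = v)"
  using assms
proof (induction es arbitrary: u)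
  case Nil
  then show ?case by (simp add: deg_def)
next
  case (Cons e es)
  then obtain w where w: "f e = Upair u w" "walk f w es v" by auto
  then have "even (deg f (set es) x) \<longleftrightarrow> (x = w \<longleftrightarrow> x = v)"
    using Cons by simp
  then show ?case
    using Cons.prems deg_insert[of "set es" e f u w x] w by auto
qed

section \<open>Euler tours\<close>

lemma euler_tour:
  assumes G: "multigraph G" "eulerian G"
  obtains u es where "u \<in> verts G" "walk (ends G) u es u" "distinct es" "set es = edges G"
proof -
  let ?f = "ends G"
  \<comment> \<open>The start must be a vertex of \<open>G\<close>; this matters for the empty
    trail, which is a walk from anywhere.\<close>
  define trail where
    "trail es \<longleftrightarrow> distinct es \<and> set es \<subseteq> edges G \<and> (\<exists>u\<in>verts G. \<exists>v. walk ?f u es v)" for es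
  have fin: "finite (edges G)" and ends: "e \<in> edges G \<Longrightarrow> set_uprod (?f e) \<subseteq> verts G" for e
    using G(1) by (auto simp: multigraph_def)
  have conn: "verts G \<noteq> {}" "\<And>x y. x \<in> verts G \<Longrightarrow> y \<in> verts G \<Longrightarrow> (x, y) \<in> (adj_rel G)\<^sup>*"
    and even: "\<And>x. x \<in> verts G \<Longrightarrow> even (deg ?f (edges G) x)"
    using G(2) by (auto simp: eulerian_def connected_graph_def degree_eq_deg)
  have bounded: "length es \<le> card (edges G)" if "trail es" for es
    using that fin card_mono by (metis distinct_card trail_def)
  have "trail []"
    using conn(1) by (auto simp: trail_def)
  then obtain es where es: "trail es" and max: "\<And>es'. trail es' \<Longrightarrow> length es' \<le> length es"
    using ex_has_greatest_nat[of trail "[]" length "Suc (card (edges G))"] bounded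
    by (metis less_Suc_eq_le)
  then obtain u v where u: "u \<in> verts G" and walk: "walk ?f u es v"
    and dist: "distinct es" and sub: "set es \<subseteq> edges G"
    by (auto simp: trail_def)
  \<comment> \<open>Maximality is phrased for every trail with the edge set of \<open>es\<close>, so
    that it covers rotations of \<open>es\<close>.\<close>
  have blocked: "e \<in> set es"
    if hyps: "walk ?f a es' b" "a \<in> verts G" "distinct es'" "set es' = set es" "e \<in> edges G"
      "b \<in> set_uprod (?f e)" for a b es' e
  proof (rule ccontr)
    assume e: "e \<notin> set es"
    obtain c where "?f e = Upair b c"
      using hyps(6) by (rule in_set_uprodE)
    then have "walk ?f a (es' @ [e]) c"
      using hyps(1) by (auto simp: walk_append)
    then have "trail (es' @ [e])"
      using hyps e sub by (auto simp: trail_def)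
    moreover have "length es' = length es"
      using hyps(3,4) dist by (metis distinct_card)
    ultimately show False
      using max by fastforce
  qed
  have closed: "v = u"
  proof (rule ccontr)
    assume neq: "v \<noteq> u"
    then have odd: "odd (deg ?f (set es) v)"
      using even_deg_trail[OF walk dist] by simp
    then have "deg ?f (set es) v > 0"
      by (simp add: odd_pos)
    then have "v \<in> verts G"
      using ends sub by (meson deg_pos subsetD)
    then have "even (deg ?f (edges G) v)"
      by (rule even)
    moreover have "deg ?f (edges G) v = deg ?f (set es) v + deg ?f (edges G - set es) v"
      using deg_Un_disjoint[of "set es" "edges G - set es" ?f v] fin sub
      by (simp add: Un_absorb1)
    ultimately have "odd (deg ?f (edges G - set es) v)"
      using odd by simp
    then have "deg ?f (edges G - set es) v > 0"
      by (simp add: odd_pos)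
    then show False
      using blocked[OF walk u dist refl] by (meson DiffE deg_pos)
  qed
  \<comment> \<open>The vertices on the trail; \<open>u\<close> is inserted because an empty trail
    has no edge to supply it.\<close>
  define S where "S = insert u (\<Union>e\<in>set es. set_uprod (?f e))"
  \<comment> \<open>A closed trail can be rotated to end at any of its vertices, so maximality applies there.\<close>
  have S: "e \<in> set es" if "x \<in> S" "e \<in> edges G" "x \<in> set_uprod (?f e)" for x e
  proof (cases "x = u")
    case True
    then show ?thesis using blocked[OF walk u dist refl] that closed by simp
  next
    case False
    then obtain e' where e': "e' \<in> set es" "x \<in> set_uprod (?f e')"
      using \<open>x \<in> S\<close> by (auto simp: S_def)
    obtain xs ys where xy: "es = xs @ ys" "walk ?f u xs x" "walk ?f x ys u"
      using walk_visits[OF walk e'] closed by metis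
    then have "walk ?f x (ys @ xs) x"
      by (auto simp: walk_append)
    moreover have "x \<in> verts G"
      using e' ends sub by blast
    moreover have "distinct (ys @ xs)" "set (ys @ xs) = set es"
      using dist xy(1) by auto
    ultimately show ?thesis
      using blocked that(2,3) by blast
  qed
  \<comment> \<open>\<open>S\<close> is closed under adjacency: an edge at a vertex of
    \<open>S\<close> is on the trail, so its other end is in \<open>S\<close> too.\<close>
  have "y \<in> S" if "(u, y) \<in> (adj_rel G)\<^sup>*" for y
    using that
  proof induction
    case base
    show ?case by (simp add: S_def)
  next
    case (step y z)
    then obtain e where "e \<in> edges G" "?f e = Upair y z"
      by (auto simp: adj_rel_def)
    moreover from this have "e \<in> set es"
      using S[OF step.IH] by simp
    ultimately show ?case
      by (force simp: S_def)
  qed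
  then have "verts G \<subseteq> S"
    using conn(2) u by blast
  have "edges G \<subseteq> set es"
  proof
    fix e assume e: "e \<in> edges G"
    obtain x y where "?f e = Upair x y" by (cases "?f e") auto
    then have "x \<in> set_uprod (?f e)" by simp
    then show "e \<in> set es"
      using S e ends \<open>verts G \<subseteq> S\<close> by blast
  qed
  then show ?thesis
    using that u walk dist sub closed by blast
qed

section \<open>Subgraphs carried by closed trails\<close>

text \<open>Only ends of edges in \<open>F\<close> become vertices, as isolated vertices could
  destroy connectedness.\<close>

definition edge_subgraph :: "('v, 'e) mgraph \<Rightarrow> 'e set \<Rightarrow> ('v, 'e) mgraph" where
  "edge_subgraph G F =
     \<lparr>verts = (\<Union>e\<in>F. set_uprod (ends G e)), edges = F, ends = ends G\<rparr>"

lemma edge_subgraph_simps [simp]: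
  "verts (edge_subgraph G F) = (\<Union>e\<in>F. set_uprod (ends G e))"
  "edges (edge_subgraph G F) = F"
  "ends (edge_subgraph G F) = ends G"
  by (simp_all add: edge_subgraph_def)

lemma subgraph_edge_subgraph:
  assumes "multigraph G" "F \<subseteq> edges G"
  shows "subgraph (edge_subgraph G F) G"
proof -
  have "finite (set_uprod p)" for p :: "'a uprod"
    by (cases p) simp
  then show ?thesis
    using assms finite_subset[OF assms(2)]
    by (auto simp: subgraph_def multigraph_def)
qed

lemma walk_reaches:
  assumes "walk (ends G) u es v" "set es \<subseteq> edges G" "e \<in> set es" "x \<in> set_uprod (ends G e)"
  shows "(u, x) \<in> (adj_rel G)\<^sup>*"
proof -
  have reach: "walk (ends G) u es v \<Longrightarrow> set es \<subseteq> edges G \<Longrightarrow> (u, v) \<in> (adj_rel G)\<^sup>*" for u es v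
  proof (induction es arbitrary: u)
    case (Cons e es)
    then obtain w where "ends G e = Upair u w" "(w, v) \<in> (adj_rel G)\<^sup>*" by auto
    moreover from this have "(u, w) \<in> adj_rel G"
      using Cons.prems by (auto simp: adj_rel_def)
    ultimately show ?case by (meson converse_rtrancl_into_rtrancl)
  qed simp
  obtain xs ys where "es = xs @ ys" "walk (ends G) u xs x"
    using walk_visits[OF assms(1,3,4)] by metis
  then show ?thesis
    using reach assms(2) by simp
qed

lemma sym_adj_rel: "sym (adj_rel G)"
proof -
  have "Upair u v = Upair v u" for u v :: 'a
    by simp
  then show ?thesis
    unfolding sym_def adj_rel_def mem_Collect_eq case_prod_conv by metis
qed

lemma closed_trail_start:
  assumes "walk (ends G) u es u" "es \<noteq> []"
  shows "u \<in> verts (edge_subgraph G (set es))"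
  using assms by (cases es) auto

text \<open>All vertices are reached from \<open>u\<close>, hence from each other by symmetry of
  adjacency. As start and end agree, \<open>even_deg_trail\<close> makes every degree even.\<close>

lemma eulerian_closed_trail:
  assumes walk: "walk (ends G) u es u" and "distinct es" "es \<noteq> []"
  shows "eulerian (edge_subgraph G (set es))"
proof -
  let ?H = "edge_subgraph G (set es)"
  have from_u: "(u, x) \<in> (adj_rel ?H)\<^sup>*" if x: "x \<in> verts ?H" for x
  proof -
    obtain e where "e \<in> set es" "x \<in> set_uprod (ends ?H e)"
      using x by auto
    moreover have "walk (ends ?H) u es u" "set es \<subseteq> edges ?H"
      using walk by simp_all
    ultimately show ?thesis
      using walk_reaches by metis
  qed
  have "(x, y) \<in> (adj_rel ?H)\<^sup>*" if "x \<in> verts ?H" "y \<in> verts ?H" for x y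
    using symD[OF sym_rtrancl[OF sym_adj_rel] from_u[OF that(1)]] from_u[OF that(2)]
    by (rule rtrancl_trans)
  moreover have "verts ?H \<noteq> {}"
    using closed_trail_start[OF assms(1,3)] by blast
  ultimately have "connected_graph ?H"
    unfolding connected_graph_def by blast
  then show ?thesis
    by (simp add: eulerian_def degree_eq_deg even_deg_trail[OF assms(1,2)])
qed

section \<open>Rooted decompositions from an Euler tour\<close>

lemma rooted_decomposition_of_closed_trails:
  assumes G: "multigraph G" and dist: "distinct (xs @ ys)" and edges: "set (xs @ ys) = edges G"
    and walks: "walk (ends G) w xs w" "walk (ends G) w ys w"
    and odd: "odd (length xs)" "odd (length ys)"
  shows "\<exists>D. two_odd_decomposition G D \<and> rooted G D"
proof -
  let ?X = "edge_subgraph G (set xs)" and ?Y = "edge_subgraph G (set ys)"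
  have ne: "xs \<noteq> []" "ys \<noteq> []" and disj: "set xs \<inter> set ys = {}"
    using odd dist by auto
  \<comment> \<open>Used twice: the two subgraphs differ, and \<open>edges\<close> is injective on
    the pair.\<close>
  then have neq: "set xs \<noteq> set ys"
    by auto
  then have "?X \<noteq> ?Y"
    by (metis edge_subgraph_simps(2))
  moreover have sub: "subgraph ?X G" "subgraph ?Y G"
    using subgraph_edge_subgraph[OF G] edges by auto
  moreover have "partition_on (edges G) (edges ` {?X, ?Y})"
    using ne disj edges by (auto simp: partition_on_def disjoint_def)
  ultimately have "two_odd_decomposition G {?X, ?Y}"
    using eulerian_closed_trail[OF walks(1) _ ne(1)] eulerian_closed_trail[OF walks(2) _ ne(2)]
      odd dist neq
    by (auto simp: two_odd_decomposition_def decomposition_def distinct_card)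
  moreover have "w \<in> verts ?X" "w \<in> verts ?Y"
    using closed_trail_start[OF walks(1) ne(1)] closed_trail_start[OF walks(2) ne(2)] by simp_all
  then have "rooted G {?X, ?Y}"
    using sub(1) unfolding rooted_def subgraph_def by blast
  ultimately show ?thesis
    by blast
qed

lemma rooted_decomposition_exists:
  assumes G: "multigraph G" "eulerian G" and nb: "\<not> bipartite G" and even: "even (card (edges G))"
  shows "\<exists>D. two_odd_decomposition G D \<and> rooted G D"
proof -
  let ?f = "ends G"
  obtain u es where walk: "walk ?f u es u" and dist: "distinct es" and set: "set es = edges G"
    using euler_tour[OF G] by metis
  \<comment> \<open>The tour stands at \<open>w\<close> after \<open>k\<close> edges. Its base
    \<open>u\<close> is visited both at 0 and at the full length.\<close>
  define visit where
    "visit w k \<longleftrightarrow> (\<exists>xs ys. es = xs @ ys \<and> length xs = k \<and> walk ?f u xs w \<and> walk ?f w ys u)"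
    for w k
  have split: "\<exists>D. two_odd_decomposition G D \<and> rooted G D"
    if ij: "visit w i" "visit w j" "i < j" "odd i \<noteq> odd j" for w i j
  proof -
    obtain xs ys xs' ys' where
      a: "es = xs @ ys" "length xs = i" "walk ?f u xs w" and
      b: "es = xs' @ ys'" "length xs' = j" "walk ?f u xs' w" "walk ?f w ys' u"
      using ij(1,2) unfolding visit_def by metis
    \<comment> \<open>Of two prefixes of \<open>es\<close> the shorter begins the longer;
      \<open>zs\<close> is the stretch between the two visits.\<close>
    then obtain zs where zs: "xs' = xs @ zs"
      using ij(3) by (auto simp: append_eq_append_conv2)
    then obtain w' where "walk ?f u xs w'" "walk ?f w' zs w"
      using b(3) by (auto simp: walk_append)
    then have "walk ?f w zs w"
      using walk_end_unique a(3) by metis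
    \<comment> \<open>The rest of the tour, continued through \<open>u\<close>, closes up at
      \<open>w\<close> as well.\<close>
    moreover have "walk ?f w (ys' @ xs) w"
      using a(3) b(4) by (auto simp: walk_append)
    moreover have "distinct (zs @ ys' @ xs)" "set (zs @ ys' @ xs) = edges G"
      using dist set b(1) zs by auto
    moreover have "odd (length zs)"
      using ij(4) a(2) b(2) zs by auto
    moreover have "even (length es)"
      using even dist set by (metis distinct_card)
    then have "odd (length (ys' @ xs))"
      using \<open>odd (length zs)\<close> b(1) zs by auto
    ultimately show ?thesis
      using rooted_decomposition_of_closed_trails[OF G(1), of zs "ys' @ xs"] by blast
  qed
  show ?thesis
  proof (rule ccontr)
    assume none: "\<not> ?thesis"
    have parity: "odd i = odd j" if "visit w i" "visit w j" for w i j
      using split that none by (metis linorder_neqE_nat)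
    \<comment> \<open>By \<open>parity\<close> all visits to a vertex agree in parity, so this is a
      well-defined colour class.\<close>
    define A where "A = {w \<in> verts G. \<exists>k. visit w k \<and> even k}"
    have "\<exists>a\<in>A. \<exists>b\<in>verts G - A. ?f e = Upair a b" if e: "e \<in> edges G" for e
    proof -
      obtain xs ys where es: "es = xs @ e # ys"
        using e set by (metis split_list)
      then obtain a b where ab: "walk ?f u xs a" "?f e = Upair a b" "walk ?f b ys u"
        using walk by (auto simp: walk_append)
      have "walk ?f u (xs @ [e]) b" "walk ?f a (e # ys) u"
        using ab by (auto simp: walk_append)
      moreover have "es = (xs @ [e]) @ ys"
        using es by simp
      ultimately have visits: "visit a (length xs)" "visit b (length (xs @ [e]))"
        using es ab unfolding visit_def by blast+
      have in_A: "w \<in> A \<longleftrightarrow> even k" if "w \<in> verts G" "visit w k" for w k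
        using that parity[OF that(2)] unfolding A_def by blast
      have "a \<in> verts G" "b \<in> verts G"
        using G(1) e ab(2) by (auto simp: multigraph_def)
      \<comment> \<open>The tour visits \<open>a\<close> and \<open>b\<close> at consecutive
        positions, just before and just after \<open>e\<close>.\<close>
      moreover have "a \<in> A \<longleftrightarrow> b \<notin> A"
        using calculation visits by (simp add: in_A)
      \<comment> \<open>The tour may cross \<open>e\<close> in either direction, so the end in
        \<open>A\<close> can be \<open>a\<close> or \<open>b\<close>.\<close>
      moreover have "?f e = Upair b a"
        using ab(2) by simp
      ultimately show ?thesis
        using ab(2) by blast
    qed
    then have "bipartite G"
      unfolding bipartite_def by (intro exI[of _ A] exI[of _ "verts G - A"]) (auto simp: A_def)
    then show False
      using nb by blast
  qed
qed

section \<open>Odd eulerian subgraphs\<close>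

text \<open>The bipartition of \<open>G\<close> restricts to \<open>H\<close>; counting the edges of
  \<open>H\<close> at their ends in \<open>A\<close> gives a sum of even degrees.\<close>

lemma even_edges_if_bipartite:
  assumes H: "multigraph H" "eulerian H" and "subgraph H G" and "bipartite G"
  shows "even (card (edges H))"
proof -
  obtain A B where AB: "A \<inter> B = {}"
    "\<And>e. e \<in> edges G \<Longrightarrow> \<exists>a\<in>A. \<exists>b\<in>B. ends G e = Upair a b"
    using assms(4) by (auto simp: bipartite_def)
  have ends: "\<exists>a\<in>A. \<exists>b\<in>B. ends H e = Upair a b" if "e \<in> edges H" for e
    using assms(3) AB(2) that by (auto simp: subgraph_def)
  let ?E = "\<lambda>a. {e \<in> edges H. a \<in> set_uprod (ends H e)}"
  have fin: "finite (verts H)" "finite (edges H)"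
    and vs: "\<And>e. e \<in> edges H \<Longrightarrow> set_uprod (ends H e) \<subseteq> verts H"
    using H(1) by (auto simp: multigraph_def)
  have "edges H = (\<Union>a\<in>A \<inter> verts H. ?E a)"
    using ends vs by fastforce
  then have "card (edges H) = card (\<Union>a\<in>A \<inter> verts H. ?E a)"
    by simp
  also have "\<dots> = (\<Sum>a\<in>A \<inter> verts H. card (?E a))"
  proof (rule card_UN_disjoint)
    \<comment> \<open>An edge has its other end in \<open>B\<close>, so no edge is counted at two
      vertices of \<open>A\<close>.\<close>
    show "\<forall>a\<in>A \<inter> verts H. \<forall>a'\<in>A \<inter> verts H. a \<noteq> a' \<longrightarrow> ?E a \<inter> ?E a' = {}"
      using ends AB(1) by fastforce
  qed (use fin in auto)
  also have "even \<dots>"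
  proof (rule dvd_sum)
    fix a assume a: "a \<in> A \<inter> verts H"
    \<comment> \<open>There are no loops, so the degree is just the number of incident
      edges.\<close>
    have "{e \<in> edges H. ends H e = Upair a a} = {}"
      using ends AB(1) by fastforce
    then have "degree H a = card (?E a)"
      by (simp only: degree_def card.empty)
    then show "even (card (?E a))"
      using H(2) a unfolding eulerian_def by (metis IntD2)
  qed
  finally show ?thesis .
qed

theorem theorem4p1:
  fixes G :: "('v, 'e) mgraph"
  assumes "multigraph G" and "eulerian G"
  shows "(\<exists>D. two_odd_decomposition G D \<and> rooted G D) \<longleftrightarrow>
    \<not> bipartite G \<and> even (card (edges G))"
proof (intro iffI)
  assume "\<exists>D. two_odd_decomposition G D \<and> rooted G D"
  then obtain D where D: "card D = 2" "\<And>H. H \<in> D \<Longrightarrow> subgraph H G" "inj_on edges D"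
    "partition_on (edges G) (edges ` D)" "\<And>H. H \<in> D \<Longrightarrow> eulerian H \<and> odd (card (edges H))"
    by (auto simp: two_odd_decomposition_def decomposition_def)
  obtain X Y where XY: "D = {X, Y}" "X \<noteq> Y"
    using D(1) by (auto simp: card_2_iff)
  have sub: "subgraph X G" "subgraph Y G"
    using D(2) XY(1) by auto
  then have "multigraph X" "multigraph Y"
    by (auto simp: subgraph_def)
  then have "\<not> bipartite G"
    using even_edges_if_bipartite[OF _ _ sub(1)] D(5)[of X] XY(1) by blast
  \<comment> \<open>The partition gives disjointness only for different blocks; injectivity of
    \<open>edges\<close> ensures that these are two.\<close>
  moreover have "edges X \<noteq> edges Y"
    using D(3) XY by auto
  then have "edges G = edges X \<union> edges Y" "edges X \<inter> edges Y = {}"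
    using D(4) XY(1) by (auto simp: partition_on_def disjoint_def)
  then have "card (edges G) = card (edges X) + card (edges Y)"
    using \<open>multigraph X\<close> \<open>multigraph Y\<close> by (simp add: multigraph_def card_Un_disjoint)
  then have "even (card (edges G))"
    using D(5) XY(1) by simp
  ultimately show "\<not> bipartite G \<and> even (card (edges G))"
    by blast
next
  assume "\<not> bipartite G \<and> even (card (edges G))"
  then show "\<exists>D. two_odd_decomposition G D \<and> rooted G D"
    using rooted_decomposition_exists[OF assms] by blast
qed

end
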